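(* Let $\mathcal H_B,\mathcal H_A,\mathcal H_E,\mathcal H_X$ be finite-dimensional complex Hilbert spaces (battery, auxiliary, environment, external), let $H_B$ be a Hermitian operator on $\mathcal H_B$, let $\rho^2_{BAE}$ be a density operator on $\mathcal H_B\otimes\mathcal H_A\otimes\mathcal H_E$, let $\rho_X$ be a density operator on $\mathcal H_X$, and set $\rho^2_S=\rho^2_{BAE}\otimes\rho_X$. Put $$\rho_B=\operatorname{tr}_{AE}[\rho^2_{BAE}],\qquad Z=\operatorname{tr}[\rho_BH_B]\,\mathbb I_{BAX}-H_B\otimes\mathbb I_{AX},\qquad \mathcal B=\operatorname{tr}_B\big[\operatorname{tr}_E(\rho^2_S)\,Z\big],$$ and let $\{\beta_i\}_i$ be the eigenvalues of the operator $\mathcal B$ on $\mathcal H_A\otimes\mathcal H_X$. Then the distillable energy $S^P_D$, the maximum stochastically extractable energy $S^P_{\max}$ and the average extractable energy $S^P_{av}$ obtained by performing the optimal POVM on the auxiliary (realized by a projective measurement on $AX$) are $$S^P_D=\sum_{i\in\mathcal I}\beta_i,\qquad S^P_{\max}=\max_i\beta_i,\qquad S^P_{av}=\sum_i\beta_i,$$ where $\mathcal I=\{i:\beta_i>0\}$ is the set of indices of the positive eigenvalues.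
   Context: Eigenvalues are listed with multiplicity; an empty sum is $0$. A POVM on the auxiliary $A$ is implemented by a rank-one projective measurement on $AX$, i.e. by an orthonormal basis $\Psi=\{|\Psi_i\rangle\}_i$ of $\mathcal H_A\otimes\mathcal H_X$ (the state $\rho_X$ is kept fixed). For outcome $i$, the unnormalized post-measurement state is $$\rho^{3,i}_{BAX}=(\mathbb I_B\otimes|\Psi_i\rangle\langle\Psi_i|)\,\operatorname{tr}_E(\rho^2_S)\,(\mathbb I_B\otimes|\Psi_i\rangle\langle\Psi_i|),$$ its probability is $p_i=\operatorname{tr}(\rho^{3,i}_{BAX})$, and the energy extracted from the battery, weighted by the probability, is $$s_i(\Psi)=p_i\,\Delta E_i=p_i\operatorname{tr}[\rho_BH_B]-\operatorname{tr}\big[H_B\operatorname{tr}_{AX}(\rho^{3,i}_{BAX})\big].$$ The three figures of merit are: - distillable energy: $S^P_D=\max_{\Psi}\sum_{i:\,s_i(\Psi)>0}s_i(\Psi)$; - maximum stochastically extractable energy: $S^P_{\max}=\max_{\Psi}\max_i s_i(\Psi)$; - average extractable energy: $S^P_{av}=\max_\Psi\sum_i s_i(\Psi)$; where all maxima over $\Psi$ run over all orthonormal bases of $\mathcal H_A\otimes\mathcal H_X$. *)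

theory Defs
  imports "HOL-Analysis.Analysis" "HOL-Computational_Algebra.Polynomial"
begin

text \<open>
  A finite-dimensional Hilbert space is \<open>complex ^ 'n\<close>; the tensor product of \<open>complex ^ 'm\<close> and
  \<open>complex ^ 'n\<close> is \<open>complex ^ ('m \<times> 'n)\<close>, and operators are square matrices in the standard basis.
\<close>

type_synonym 'n operator = "complex ^ 'n ^ 'n"

text \<open>The inner product of the library on \<open>complex ^ 'n\<close> is real-valued, hence not usable here.\<close>

definition cinner :: "complex ^ 'n::finite \<Rightarrow> complex ^ 'n \<Rightarrow> complex" where
  "cinner u v = (\<Sum>i\<in>UNIV. cnj (u $ i) * v $ i)"

definition hermitian :: "'n::finite operator \<Rightarrow> bool" where
  "hermitian M \<longleftrightarrow> (\<forall>i j. M $ i $ j = cnj (M $ j $ i))"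

definition density_operator :: "'n::finite operator \<Rightarrow> bool" where
  "density_operator \<rho> \<longleftrightarrow>
     hermitian \<rho> \<and> (\<forall>v. 0 \<le> Re (cinner v (\<rho> *v v))) \<and> trace \<rho> = 1"

definition tensor :: "'m::finite operator \<Rightarrow> 'n::finite operator \<Rightarrow> ('m \<times> 'n) operator" (infixr "\<otimes>" 75) where
  "M \<otimes> N = (\<chi> r c. M $ fst r $ fst c * N $ snd r $ snd c)"

definition ptrace_fst :: "('m::finite \<times> 'n::finite) operator \<Rightarrow> 'n operator" where
  "ptrace_fst M = (\<chi> j l. \<Sum>i\<in>UNIV. M $ (i, j) $ (i, l))"

definition ptrace_snd :: "('m::finite \<times> 'n::finite) operator \<Rightarrow> 'm operator" where
  "ptrace_snd M = (\<chi> i k. \<Sum>j\<in>UNIV. M $ (i, j) $ (k, j))"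

text \<open>Partial trace over \<open>E\<close> from \<open>(BAE)X\<close> to \<open>BAX\<close>; pairs associate to the right.\<close>

definition ptrace_E ::
  "(('b::finite \<times> 'a::finite \<times> 'e::finite) \<times> 'x::finite) operator \<Rightarrow> ('b \<times> 'a \<times> 'x) operator" where
  "ptrace_E M = (\<chi> r c. case (r, c) of ((b, a, x), (b', a', x')) \<Rightarrow>
     \<Sum>e\<in>UNIV. M $ ((b, a, e), x) $ ((b', a', e), x'))"

definition projector :: "complex ^ 'n::finite \<Rightarrow> 'n operator" where
  "projector \<psi> = (\<chi> i j. \<psi> $ i * cnj (\<psi> $ j))"

text \<open>The index type has as many elements as the dimension, so orthonormality already forces
  the vectors to span the space.\<close>

definition orthonormal_basis :: "('n::finite \<Rightarrow> complex ^ 'n) \<Rightarrow> bool" where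
  "orthonormal_basis \<Psi> \<longleftrightarrow> (\<forall>i j. cinner (\<Psi> i) (\<Psi> j) = (if i = j then 1 else 0))"

lemma orthonormal_basis_expansion:
  assumes "orthonormal_basis \<Psi>"
  shows "v = (\<Sum>i\<in>UNIV. cinner (\<Psi> i) v *s \<Psi> i)"
proof -
  define P Q :: "complex ^ 'a ^ 'a" where "P = (\<chi> i j. \<Psi> j $ i)" and "Q = (\<chi> i j. cnj (\<Psi> i $ j))"
  have "Q ** P = mat 1"
    using assms
    by (simp add: P_def Q_def matrix_matrix_mult_def mat_def vec_eq_iff orthonormal_basis_def cinner_def)
  then have "P ** Q = mat 1"
    by (simp add: matrix_left_right_inverse)
  then have "v = P *v (Q *v v)"
    by (simp add: matrix_vector_mul_assoc)
  also have "\<dots> = (\<Sum>i\<in>UNIV. cinner (\<Psi> i) v *s \<Psi> i)"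
    by (simp add: P_def Q_def matrix_vector_mult_def vec_eq_iff cinner_def mult.commute)
  finally show ?thesis .
qed

definition charpoly :: "'n::finite operator \<Rightarrow> complex poly" where
  "charpoly M = det (\<chi> i j. (if i = j then [:0, 1:] else 0) - [:M $ i $ j:])"

text \<open>The family \<open>\<beta>\<close> lists every eigenvalue as often as its multiplicity as a root of the
  characteristic polynomial. No operator is assumed to have real eigenvalues.\<close>

definition eigenvalue_family :: "('n::finite \<Rightarrow> complex) \<Rightarrow> 'n operator \<Rightarrow> bool" where
  "eigenvalue_family \<beta> M \<longleftrightarrow> (\<forall>z. card {i. \<beta> i = z} = order z (charpoly M))"

lemma poly_charpoly: "poly (charpoly M) z = det (mat z - M)"
  by (auto simp: charpoly_def det_def poly_sum poly_prod mat_def intro!: sum.cong prod.cong)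

lemma poly_charpoly_eq_0_iff: "poly (charpoly M) z = 0 \<longleftrightarrow> (\<exists>v. v \<noteq> 0 \<and> M *v v = z *s v)"
proof -
  have mat: "mat z *v v = z *s v" for v :: "complex ^ 'a"
    by (simp add: matrix_vector_mult_def mat_def vec_eq_iff if_distrib if_distribR cong: if_cong)
  have "poly (charpoly M) z = 0 \<longleftrightarrow> \<not> invertible (mat z - M)"
    by (simp add: poly_charpoly invertible_det_nz)
  also have "\<dots> \<longleftrightarrow> (\<exists>v. v \<noteq> 0 \<and> (mat z - M) *v v = 0)"
    by (auto simp: invertible_left_inverse matrix_left_invertible_ker)
  finally show ?thesis
    by (auto simp: matrix_vector_mult_diff_rdistrib mat)
qed

text \<open>
  \<open>HB\<close> is the Hamiltonian of the battery, \<open>\<rho>\<close> the state of \<open>BAE\<close> and \<open>\<rho>X\<close> the state of \<open>X\<close>.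
  Traces of products of Hermitian operators are real, so \<open>Re\<close> below is only a coercion.
  The post-measurement state is not normalized, so \<open>weighted_energy\<close> is the extracted energy
  already multiplied by the probability of the outcome.
\<close>

definition battery_state :: "('b::finite \<times> 'a::finite \<times> 'e::finite) operator \<Rightarrow> 'b operator" where
  "battery_state \<rho> = ptrace_snd \<rho>"

definition Z_operator :: "'b::finite operator \<Rightarrow> ('b \<times> 'a::finite \<times> 'e::finite) operator
    \<Rightarrow> ('b \<times> 'a \<times> 'x::finite) operator" where
  "Z_operator HB \<rho> = mat (trace (battery_state \<rho> ** HB)) - HB \<otimes> mat 1"

definition B_operator :: "'b::finite operator \<Rightarrow> ('b \<times> 'a::finite \<times> 'e::finite) operator
    \<Rightarrow> 'x::finite operator \<Rightarrow> ('a \<times> 'x) operator" where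
  "B_operator HB \<rho> \<rho>X = ptrace_fst (ptrace_E (\<rho> \<otimes> \<rho>X) ** Z_operator HB \<rho>)"

definition post_state :: "('b::finite \<times> 'a::finite \<times> 'e::finite) operator \<Rightarrow> 'x::finite operator
    \<Rightarrow> complex ^ ('a \<times> 'x) \<Rightarrow> ('b \<times> 'a \<times> 'x) operator" where
  "post_state \<rho> \<rho>X \<psi> =
     (mat 1 \<otimes> projector \<psi>) ** ptrace_E (\<rho> \<otimes> \<rho>X) ** (mat 1 \<otimes> projector \<psi>)"

definition weighted_energy :: "'b::finite operator \<Rightarrow> ('b \<times> 'a::finite \<times> 'e::finite) operator
    \<Rightarrow> 'x::finite operator \<Rightarrow> complex ^ ('a \<times> 'x) \<Rightarrow> real" where
  "weighted_energy HB \<rho> \<rho>X \<psi> =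
     (let \<rho>3 = post_state \<rho> \<rho>X \<psi>; p = Re (trace \<rho>3)
      in p * Re (trace (battery_state \<rho> ** HB)) - Re (trace (HB ** ptrace_snd \<rho>3)))"

definition distilled :: "'b::finite operator \<Rightarrow> ('b \<times> 'a::finite \<times> 'e::finite) operator
    \<Rightarrow> 'x::finite operator \<Rightarrow> ('a \<times> 'x \<Rightarrow> complex ^ ('a \<times> 'x)) \<Rightarrow> real" where
  "distilled HB \<rho> \<rho>X \<Psi> =
     (\<Sum>i | weighted_energy HB \<rho> \<rho>X (\<Psi> i) > 0. weighted_energy HB \<rho> \<rho>X (\<Psi> i))"

definition best_outcome :: "'b::finite operator \<Rightarrow> ('b \<times> 'a::finite \<times> 'e::finite) operator
    \<Rightarrow> 'x::finite operator \<Rightarrow> ('a \<times> 'x \<Rightarrow> complex ^ ('a \<times> 'x)) \<Rightarrow> real" where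
  "best_outcome HB \<rho> \<rho>X \<Psi> = (MAX i. weighted_energy HB \<rho> \<rho>X (\<Psi> i))"

definition average :: "'b::finite operator \<Rightarrow> ('b \<times> 'a::finite \<times> 'e::finite) operator
    \<Rightarrow> 'x::finite operator \<Rightarrow> ('a \<times> 'x \<Rightarrow> complex ^ ('a \<times> 'x)) \<Rightarrow> real" where
  "average HB \<rho> \<rho>X \<Psi> = (\<Sum>i\<in>UNIV. weighted_energy HB \<rho> \<rho>X (\<Psi> i))"

text \<open>The maxima range over infinite sets, where \<open>Max\<close> is unspecified; \<open>GREATEST\<close> is the greatest
  element provided that one exists.\<close>

definition S_D :: "'b::finite operator \<Rightarrow> ('b \<times> 'a::finite \<times> 'e::finite) operator
    \<Rightarrow> 'x::finite operator \<Rightarrow> real" where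
  "S_D HB \<rho> \<rho>X = (GREATEST s. \<exists>\<Psi>. orthonormal_basis \<Psi> \<and> s = distilled HB \<rho> \<rho>X \<Psi>)"

definition S_max :: "'b::finite operator \<Rightarrow> ('b \<times> 'a::finite \<times> 'e::finite) operator
    \<Rightarrow> 'x::finite operator \<Rightarrow> real" where
  "S_max HB \<rho> \<rho>X = (GREATEST s. \<exists>\<Psi>. orthonormal_basis \<Psi> \<and> s = best_outcome HB \<rho> \<rho>X \<Psi>)"

definition S_av :: "'b::finite operator \<Rightarrow> ('b \<times> 'a::finite \<times> 'e::finite) operator
    \<Rightarrow> 'x::finite operator \<Rightarrow> real" where
  "S_av HB \<rho> \<rho>X = (GREATEST s. \<exists>\<Psi>. orthonormal_basis \<Psi> \<and> s = average HB \<rho> \<rho>X \<Psi>)"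

end

theory Submission
  imports Defs "HOL-Combinatorics.Permutations"
begin

text \<open>
  For a unit vector \<open>\<psi>\<close> the weighted energy is the quadratic form \<open>\<langle>\<psi>, \<B> \<psi>\<rangle>\<close> of the Hermitian operator
  \<open>\<B>\<close>. Expanding an orthonormal basis \<open>\<Psi>\<close> in an orthonormal eigenbasis \<open>\<Phi>\<close> of \<open>\<B>\<close> turns the energies
  into averages of the eigenvalues \<open>\<beta>\<^sub>i\<close> with the doubly stochastic weights \<open>\<bar>\<langle>\<Phi>\<^sub>i, \<Psi>\<^sub>j\<rangle>\<bar>\<^sup>2\<close>. Averaging
  preserves the sum, increases neither the maximum nor the sum of the positive parts, and all three
  bounds are attained at \<open>\<Psi> = \<Phi>\<close>.
\<close>

subsection \<open>The complex inner product\<close>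

lemma cinner_commute: "cinner u v = cnj (cinner v u)"
  by (simp add: cinner_def mult.commute)

lemma cmod_cinner_commute: "cmod (cinner u v) = cmod (cinner v u)"
  by (metis cinner_commute complex_mod_cnj)

lemma cinner_add_right: "cinner u (v + w) = cinner u v + cinner u w"
  by (simp add: cinner_def distrib_left sum.distrib)

lemma cinner_diff_right: "cinner u (v - w) = cinner u v - cinner u w"
  by (simp add: cinner_def right_diff_distrib sum_subtractf)

lemma cinner_scale_right: "cinner u (c *s v) = c * cinner u v"
  by (simp add: cinner_def sum_distrib_left mult_ac)

lemma cinner_zero_right [simp]: "cinner u 0 = 0"
  by (simp add: cinner_def)

lemma cinner_sum_right: "cinner u (sum f A) = (\<Sum>i\<in>A. cinner u (f i))"
  by (induction A rule: infinite_finite_induct) (simp_all add: cinner_add_right)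

lemma cinner_diff_left: "cinner (v - w) u = cinner v u - cinner w u"
  by (simp add: cinner_def left_diff_distrib sum_subtractf)

lemma cinner_scale_left: "cinner (c *s v) u = cnj c * cinner v u"
  by (simp add: cinner_def sum_distrib_left mult_ac)

text \<open>Connects \<open>cinner\<close> to the real inner product of the library, which makes its
  norm, topology and compactness available for the spectral theorem.\<close>

lemma Re_cinner: "Re (cinner u v) = u \<bullet> v"
  by (simp add: cinner_def inner_vec_def inner_complex_def)

lemma cinner_self: "cinner v v = complex_of_real ((norm v)\<^sup>2)"
proof (rule complex_eqI)
  have "Im (cinner v v) = - Im (cinner v v)"
    using arg_cong[OF cinner_commute[of v v], of Im] by simp
  then show "Im (cinner v v) = Im (complex_of_real ((norm v)\<^sup>2))"
    by simp
qed (simp add: Re_cinner power2_norm_eq_inner)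

lemma hermitian_nth: "hermitian M \<Longrightarrow> cnj (M $ i $ j) = M $ j $ i"
  by (metis hermitian_def)

lemma cinner_hermitian:
  assumes "hermitian M"
  shows "cinner u (M *v v) = cinner (M *v u) v"
proof -
  have "cinner u (M *v v) = (\<Sum>i\<in>UNIV. \<Sum>j\<in>UNIV. cnj (u $ i) * (M $ i $ j * v $ j))"
    by (simp add: cinner_def matrix_vector_mult_def sum_distrib_left)
  also have "\<dots> = (\<Sum>j\<in>UNIV. \<Sum>i\<in>UNIV. cnj (u $ i) * (M $ i $ j * v $ j))"
    by (rule sum.swap)
  also have "\<dots> = (\<Sum>j\<in>UNIV. \<Sum>i\<in>UNIV. cnj (u $ i) * (cnj (M $ j $ i) * v $ j))"
    by (simp add: hermitian_nth[OF assms])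
  also have "\<dots> = cinner (M *v u) v"
    by (simp add: cinner_def matrix_vector_mult_def sum_distrib_left sum_distrib_right mult_ac)
  finally show ?thesis .
qed

lemma orthonormal_basis_unit: "orthonormal_basis \<Psi> \<Longrightarrow> cinner (\<Psi> i) (\<Psi> i) = 1"
  by (simp add: orthonormal_basis_def)

lemma orthonormal_basis_parseval:
  assumes "orthonormal_basis \<Psi>"
  shows "cinner v v = (\<Sum>i\<in>UNIV. (cmod (cinner (\<Psi> i) v))\<^sup>2)"
proof -
  have "cinner v v = cinner v (\<Sum>i\<in>UNIV. cinner (\<Psi> i) v *s \<Psi> i)"
    using orthonormal_basis_expansion[OF assms, of v] by simp
  also have "\<dots> = (\<Sum>i\<in>UNIV. cinner (\<Psi> i) v * cnj (cinner (\<Psi> i) v))"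
    by (simp add: cinner_sum_right cinner_scale_right cinner_commute[of v])
  also have "\<dots> = (\<Sum>i\<in>UNIV. (cmod (cinner (\<Psi> i) v))\<^sup>2)"
    by (simp flip: complex_norm_square)
  finally show ?thesis .
qed

subsection \<open>The spectral theorem\<close>

text \<open>A dimension count: the orthogonality conditions form a square linear system whose row
  \<open>i\<close> is zero, so its matrix is singular and has a nonzero kernel vector.\<close>

lemma exists_orthogonal_vector:
  fixes \<Psi> :: "'n::finite \<Rightarrow> complex ^ 'n"
  assumes "i \<notin> I"
  shows "\<exists>v. v \<noteq> 0 \<and> (\<forall>j\<in>I. cinner (\<Psi> j) v = 0)"
proof -
  define Q :: "complex ^ 'n ^ 'n" where "Q = (\<chi> j k. if j \<in> I then cnj (\<Psi> j $ k) else 0)"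
  have "row i Q = 0"
    using assms by (simp add: Q_def row_def vec_eq_iff)
  then have "\<not> invertible Q"
    by (simp add: invertible_det_nz det_zero_row)
  then obtain v where v: "v \<noteq> 0" "Q *v v = 0"
    by (auto simp: invertible_left_inverse matrix_left_invertible_ker)
  have "cinner (\<Psi> j) v = (Q *v v) $ j" if "j \<in> I" for j
    using that by (simp add: Q_def cinner_def matrix_vector_mult_def)
  with v show ?thesis
    by auto
qed

text \<open>A maximizer of the Rayleigh quotient on the orthogonal complement of the eigenvectors already
  found is a further eigenvector: there \<open>N = \<kappa> - M\<close> is nonnegative with \<open>\<langle>v, N v\<rangle> = 0\<close>, and testing it at
  \<open>v - t N v\<close> for small \<open>t > 0\<close> forces \<open>N v = 0\<close>.\<close>

lemma exists_orthogonal_eigenvector: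
  fixes M :: "'n::finite operator" and I :: "'n set"
  assumes M: "hermitian M"
    and eig: "\<And>j. j \<in> I \<Longrightarrow> M *v \<Psi> j = complex_of_real (\<mu> j) *s \<Psi> j"
    and "i \<notin> I"
  shows "\<exists>v \<kappa>. cinner v v = 1 \<and> (\<forall>j\<in>I. cinner (\<Psi> j) v = 0) \<and> M *v v = complex_of_real \<kappa> *s v"
proof -
  define W where "W = {v. \<forall>j\<in>I. cinner (\<Psi> j) v = 0}"
  define q where "q v = Re (cinner v (M *v v))" for v
  have W_scale: "c *s v \<in> W" if "v \<in> W" for c v
    using that by (simp add: W_def cinner_scale_right)
  have W_diff: "v - w \<in> W" if "v \<in> W" "w \<in> W" for v w
    using that by (simp add: W_def cinner_diff_right)
  have q_scale: "q (complex_of_real c *s v) = c\<^sup>2 * q v" for c v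
    by (simp add: q_def vector_scalar_commute cinner_scale_left cinner_scale_right power2_eq_square)
  have norm_scale: "norm (complex_of_real c *s v) = \<bar>c\<bar> * norm v" for c and v :: "complex ^ 'n"
  proof -
    have "complex_of_real c *s v = c *\<^sub>R v"
      by (simp add: vec_eq_iff scaleR_conv_of_real[where 'a = complex])
    then show ?thesis by simp
  qed
  have "W = (\<Inter>j\<in>I. {v. cinner (\<Psi> j) v = 0})"
    by (auto simp: W_def)
  then have "closed W"
    unfolding cinner_def by (auto intro!: closed_INT closed_Collect_eq continuous_intros)
  then have compact: "compact (sphere 0 1 \<inter> W)"
    by (simp add: compact_Int_closed)
  obtain v0 where v0: "v0 \<noteq> 0" "v0 \<in> W"
    using exists_orthogonal_vector[OF \<open>i \<notin> I\<close>, of \<Psi>] by (auto simp: W_def)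
  have "complex_of_real (1 / norm v0) *s v0 \<in> sphere 0 1 \<inter> W"
    using v0 W_scale[of v0] norm_scale[of "1 / norm v0" v0] by simp
  then have nonempty: "sphere 0 1 \<inter> W \<noteq> {}"
    by blast
  have "continuous_on (sphere 0 1 \<inter> W) q"
    unfolding q_def cinner_def matrix_vector_mult_def by (simp, intro continuous_intros)
  then obtain v where "v \<in> sphere 0 1 \<inter> W" and ge_q: "\<forall>w\<in>sphere 0 1 \<inter> W. q w \<le> q v"
    using continuous_attains_sup[OF compact nonempty] by blast
  then have v: "v \<in> W" "norm v = 1"
    by auto
  have max: "q w \<le> q v" if "w \<in> W" "norm w = 1" for w
    using that ge_q by simp
  define \<kappa> where "\<kappa> = q v"
  define N where "N w = complex_of_real \<kappa> *s w - M *v w" for w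
  have q_N: "Re (cinner w (N w)) = \<kappa> * (norm w)\<^sup>2 - q w" for w
    by (simp add: N_def q_def cinner_diff_right cinner_scale_right cinner_self flip: of_real_power)
  \<comment> \<open>The bound by \<open>\<kappa>\<close> is known on unit vectors of
    \<open>W\<close> only; the quadratic homogeneity of \<open>q\<close> extends it to all of
    \<open>W\<close>.\<close>
  have N_nonneg: "0 \<le> Re (cinner w (N w))" if "w \<in> W" for w
  proof (cases "w = 0")
    case False
    then have "q (complex_of_real (1 / norm w) *s w) \<le> \<kappa>"
      using that W_scale[of w] norm_scale[of "1 / norm w" w] by (auto simp: \<kappa>_def intro!: max)
    then have "q w / (norm w)\<^sup>2 \<le> \<kappa>"
      using q_scale[of "1 / norm w" w] by (simp add: power_divide)
    then show ?thesis
      using False by (simp add: q_N divide_simps split: if_splits)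
  qed (simp add: N_def)
  have N_self_adjoint: "cinner u (N w) = cinner (N u) w" for u w
    by (simp add: N_def cinner_diff_right cinner_diff_left cinner_scale_right cinner_scale_left
        cinner_hermitian[OF M])
  \<comment> \<open>\<open>N\<close> is self-adjoint and maps each \<open>\<Psi> j\<close> with
    \<open>j\<close> in \<open>I\<close> to a multiple of itself, so it preserves the orthogonal
    complement \<open>W\<close>.\<close>
  have N_v_W: "N v \<in> W"
    unfolding W_def
  proof (intro CollectI ballI)
    fix j assume j: "j \<in> I"
    show "cinner (\<Psi> j) (N v) = 0"
      unfolding N_self_adjoint using v(1) j
      by (simp add: N_def eig cinner_diff_left cinner_scale_left W_def)
  qed
  have N_diff: "N (u - w) = N u - N w" for u w
    by (simp add: N_def vector_ssub_ldistrib matrix_vector_mult_diff_distrib)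
  have N_scale: "N (c *s w) = c *s N w" for c w
    by (simp add: N_def vector_ssub_ldistrib vector_smult_assoc mult.commute vector_scalar_commute)
  define a where "a = (norm (N v))\<^sup>2"
  define b where "b = Re (cinner (N v) (N (N v)))"
  \<comment> \<open>The quadratic form of \<open>N\<close> at \<open>v - t N v\<close>: its constant
    term vanishes by the choice of \<open>\<kappa>\<close>, and each of the two cross terms
    contributes \<open>- t * a\<close>.\<close>
  have ge: "0 \<le> - 2 * t * a + t\<^sup>2 * b" for t
  proof -
    let ?w = "v - complex_of_real t *s N v"
    have "Re (cinner v (N v)) = 0"
      by (simp add: q_N \<kappa>_def v(2))
    moreover have "cinner v (N (N v)) = complex_of_real a"
      by (simp add: N_self_adjoint[of v] cinner_self a_def)
    ultimately have "Re (cinner ?w (N ?w)) = - 2 * t * a + t\<^sup>2 * b"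
      by (simp add: N_diff N_scale cinner_diff_left cinner_diff_right cinner_scale_left
          cinner_scale_right cinner_self a_def b_def power2_eq_square right_diff_distrib flip: of_real_power)
    moreover have "?w \<in> W"
      using v(1) N_v_W by (intro W_diff W_scale)
    ultimately show ?thesis
      using N_nonneg by metis
  qed
  have "a = 0"
  proof (rule ccontr)
    assume "a \<noteq> 0"
    then have "a > 0" by (simp add: a_def)
    have "b \<ge> 0"
      unfolding b_def by (rule N_nonneg[OF N_v_W])
    \<comment> \<open>Small enough that the quadratic term \<open>t\<^sup>2 * b\<close> is at most
      \<open>t * a\<close> and cannot compensate \<open>- 2 * t * a\<close>; the added 1 keeps the
      denominator positive when \<open>b = 0\<close>.\<close>
    define t where "t = a / (b + 1)"
    have "t > 0" "t * b \<le> a"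
      using \<open>a > 0\<close> \<open>b \<ge> 0\<close> by (simp_all add: t_def field_simps)
    then have "t * (t * b) \<le> t * a" "t * a > 0"
      using \<open>a > 0\<close> by (simp_all add: mult_left_mono)
    then show False
      using ge[of t] by (simp add: power2_eq_square)
  qed
  then have "M *v v = complex_of_real \<kappa> *s v"
    by (simp add: a_def N_def)
  moreover have "cinner v v = 1"
    by (simp add: cinner_self v(2))
  ultimately show ?thesis
    using v(1) by (auto simp: W_def)
qed

text \<open>Eigenvectors are adjoined one index at a time. The claim for a subset \<open>I\<close>
  constrains \<open>\<Psi>\<close> and \<open>\<mu>\<close> on \<open>I\<close> only, so an update
  at the new index extends both.\<close>

lemma hermitian_eigenbasis:
  fixes M :: "'n::finite operator"
  assumes "hermitian M"
  obtains \<Psi> \<mu> where "orthonormal_basis \<Psi>" "\<And>i. M *v \<Psi> i = complex_of_real (\<mu> i) *s \<Psi> i"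
proof -
  have "\<exists>\<Psi> \<mu>. (\<forall>i\<in>I. \<forall>j\<in>I. cinner (\<Psi> i) (\<Psi> j) = (if i = j then 1 else 0)) \<and>
      (\<forall>i\<in>I. M *v \<Psi> i = complex_of_real (\<mu> i) *s \<Psi> i)" for I :: "'n set"
    using finite[of I]
  proof (induction I rule: finite_induct)
    case (insert i I)
    then obtain \<Psi> \<mu>
      where on: "\<forall>i\<in>I. \<forall>j\<in>I. cinner (\<Psi> i) (\<Psi> j) = (if i = j then 1 else 0)"
        and eig: "\<forall>i\<in>I. M *v \<Psi> i = complex_of_real (\<mu> i) *s \<Psi> i"
      by auto
    obtain v \<kappa> where v: "cinner v v = 1" "\<forall>j\<in>I. cinner (\<Psi> j) v = 0"
        "M *v v = complex_of_real \<kappa> *s v"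
      using exists_orthogonal_eigenvector[OF assms, of I \<Psi> \<mu> i] eig insert.hyps by auto
    then have "\<forall>j\<in>I. cinner v (\<Psi> j) = 0"
      by (metis cinner_commute complex_cnj_zero)
    then show ?case
      using on eig v insert.hyps
      by (intro exI[of _ "\<Psi>(i := v)"] exI[of _ "\<mu>(i := \<kappa>)"]) auto
  qed simp
  from this[of UNIV] show ?thesis
    using that by (auto simp: orthonormal_basis_def)
qed


section \<open>Characteristic polynomial and matching of eigenvalue lists\<close>

lemma matrix_diff_ldistrib: "A ** (B - C) = A ** B - A ** C" for A :: "'a::ring_1 ^ 'n ^ 'm"
  by (simp add: matrix_matrix_mult_def vec_eq_iff right_diff_distrib sum_subtractf)

lemma matrix_diff_rdistrib: "(A - B) ** C = A ** C - B ** C" for A :: "'a::ring_1 ^ 'n ^ 'm"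
  by (simp add: matrix_matrix_mult_def vec_eq_iff left_diff_distrib sum_subtractf)

text \<open>With the eigenvectors as columns of \<open>P\<close>, diagonalization reads
  \<open>(mat z - M) ** P = P ** D\<close>; taking determinants and cancelling \<open>det P\<close>
  gives the value at each \<open>z\<close>. Complex polynomials that agree at every point are
  equal.\<close>

lemma charpoly_eq_prod_eigenvalues:
  fixes M :: "'n::finite operator"
  assumes "orthonormal_basis \<Psi>" and eig: "\<And>i. M *v \<Psi> i = \<mu> i *s \<Psi> i"
  shows "charpoly M = (\<Prod>i\<in>UNIV. [:- \<mu> i, 1:])"
proof -
  define P Q :: "complex ^ 'n ^ 'n" where "P = (\<chi> i j. \<Psi> j $ i)" and "Q = (\<chi> i j. cnj (\<Psi> i $ j))"
  have QP: "Q ** P = mat 1"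
    using assms(1)
    by (simp add: P_def Q_def matrix_matrix_mult_def mat_def vec_eq_iff orthonormal_basis_def cinner_def)
  have "poly (charpoly M) z = poly (\<Prod>i\<in>UNIV. [:- \<mu> i, 1:]) z" for z
  proof -
    define D :: "complex ^ 'n ^ 'n" where "D = (\<chi> i j. if i = j then z - \<mu> i else 0)"
    have "(M ** P) $ i $ j = \<mu> j * P $ i $ j" for i j
      using arg_cong[OF eig[of j], of "\<lambda>v. v $ i"]
      by (simp add: P_def matrix_matrix_mult_def matrix_vector_mult_def)
    moreover have "(mat z ** P) $ i $ j = z * P $ i $ j" for i j
      by (simp add: matrix_matrix_mult_def mat_def if_distrib if_distribR cong: if_cong)
    moreover have "(P ** D) $ i $ j = (z - \<mu> j) * P $ i $ j" for i j
      by (simp add: matrix_matrix_mult_def D_def if_distrib if_distribR mult.commute cong: if_cong)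
    ultimately have "(mat z - M) ** P = P ** D"
      by (simp add: vec_eq_iff matrix_diff_rdistrib left_diff_distrib)
    then have "det (mat z - M) * det P = det P * det D"
      by (metis det_mul)
    moreover have "det P \<noteq> 0"
      using QP by (metis det_I det_mul mult_zero_right zero_neq_one)
    ultimately have "det (mat z - M) = det D"
      by (simp add: mult.commute)
    also have "\<dots> = (\<Prod>i\<in>UNIV. z - \<mu> i)"
      by (subst det_diagonal) (simp_all add: D_def)
    finally show ?thesis
      by (simp add: poly_charpoly poly_prod)
  qed
  then show ?thesis
    by (simp add: poly_eq_poly_eq_iff[symmetric] fun_eq_iff)
qed

text \<open>The given family \<open>\<beta>\<close> and the eigenvalues \<open>\<mu>\<close> of a
  constructed eigenbasis both list the roots of \<open>charpoly M\<close> with multiplicity. They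
  differ by a permutation, and reindexing the basis by it pairs each \<open>\<beta> i\<close> with
  its own eigenvector. This also shows that \<open>\<beta>\<close> is real.\<close>

lemma hermitian_eigenvalue_family:
  fixes M :: "'n::finite operator"
  assumes "hermitian M" and fam: "eigenvalue_family \<beta> M"
  obtains \<Phi> b where "orthonormal_basis \<Phi>" "\<And>i. \<beta> i = complex_of_real (b i)"
    "\<And>i. M *v \<Phi> i = complex_of_real (b i) *s \<Phi> i"
proof -
  obtain \<Psi> \<mu> where on: "orthonormal_basis \<Psi>"
      and eig: "\<And>i. M *v \<Psi> i = complex_of_real (\<mu> i) *s \<Psi> i"
    using hermitian_eigenbasis[OF assms(1)] by blast
  have char: "charpoly M = (\<Prod>i\<in>UNIV. [:- complex_of_real (\<mu> i), 1:])"
    by (rule charpoly_eq_prod_eigenvalues[OF on eig])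
  \<comment> \<open>The multiset \<open>proots\<close> counts every point with its
    \<open>order\<close> only for a nonzero polynomial.\<close>
  then have nz: "charpoly M \<noteq> 0"
    by simp
  have "proots (charpoly M) = (\<Sum>i\<in>UNIV. {#complex_of_real (\<mu> i)#})"
    unfolding char by (subst proots_prod) auto
  also have "\<dots> = image_mset (\<lambda>i. complex_of_real (\<mu> i)) (mset_set UNIV)"
    by (simp add: sum_unfold_sum_mset)
  finally have proots: "proots (charpoly M) = image_mset (\<lambda>i. complex_of_real (\<mu> i)) (mset_set UNIV)" .
  have "count (image_mset \<beta> (mset_set UNIV)) z = count (proots (charpoly M)) z" for z
    using fam nz by (simp add: count_image_mset_eq_card_vimage eigenvalue_family_def)
  then have "image_mset \<beta> (mset_set UNIV) = image_mset (\<lambda>i. complex_of_real (\<mu> i)) (mset_set UNIV)"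
    by (simp add: multiset_eq_iff proots)
  then obtain p where p: "p permutes UNIV" "\<forall>i\<in>UNIV. \<beta> i = complex_of_real (\<mu> (p i))"
    by (rule image_mset_eq_implies_permutes[OF finite])
  have "p i = p j \<longleftrightarrow> i = j" for i j
    using permutes_inj[OF p(1)] by (simp add: inj_eq)
  then have "orthonormal_basis (\<Psi> \<circ> p)"
    using on by (simp add: orthonormal_basis_def)
  then show ?thesis
    using p(2) eig by (intro that[of "\<Psi> \<circ> p" "\<mu> \<circ> p"]) auto
qed

subsection \<open>Quadratic forms on orthonormal bases\<close>

lemma quadratic_form_eigenbasis:
  assumes "orthonormal_basis \<Phi>" and "\<And>i. M *v \<Phi> i = complex_of_real (b i) *s \<Phi> i"
  shows "Re (cinner v (M *v v)) = (\<Sum>i\<in>UNIV. b i * (cmod (cinner (\<Phi> i) v))\<^sup>2)"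
proof -
  have "M *v v = M *v (\<Sum>i\<in>UNIV. cinner (\<Phi> i) v *s \<Phi> i)"
    using orthonormal_basis_expansion[OF assms(1), of v] by simp
  also have "\<dots> = (\<Sum>i\<in>UNIV. (cinner (\<Phi> i) v * complex_of_real (b i)) *s \<Phi> i)"
    by (simp add: vec.linear_sum[OF matrix_vector_mul_linear_gen] vector_scalar_commute
        assms(2) vector_smult_assoc)
  finally have "cinner v (M *v v)
      = (\<Sum>i\<in>UNIV. complex_of_real (b i) * (cinner (\<Phi> i) v * cnj (cinner (\<Phi> i) v)))"
    by (simp add: cinner_sum_right cinner_scale_right cinner_commute[of v] mult_ac)
  also have "\<dots> = complex_of_real (\<Sum>i\<in>UNIV. b i * (cmod (cinner (\<Phi> i) v))\<^sup>2)"
    by (simp flip: complex_norm_square)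
  finally show ?thesis
    by simp
qed

lemma orthonormal_basis_weights_sum:
  assumes "orthonormal_basis \<Psi>" and "cinner v v = 1"
  shows "(\<Sum>i\<in>UNIV. (cmod (cinner (\<Psi> i) v))\<^sup>2) = 1"
  using orthonormal_basis_parseval[OF assms(1), of v] assms(2)
  by (metis of_real_eq_1_iff)

text \<open>After exchanging the sums, the weights for a fixed \<open>i\<close> add up to one by
  Parseval in the basis \<open>\<Psi>\<close> for the unit vector \<open>\<Phi> i\<close>. This is
  one half of double stochasticity; \<open>orthonormal_basis_weights_sum\<close> gives the
  other.\<close>

lemma orthonormal_bases_average:
  assumes "orthonormal_basis \<Phi>" and "orthonormal_basis \<Psi>"
  shows "(\<Sum>j\<in>UNIV. \<Sum>i\<in>UNIV. f i * (cmod (cinner (\<Phi> i) (\<Psi> j)))\<^sup>2) = (\<Sum>i\<in>UNIV. f i)"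
proof -
  have "(\<Sum>j\<in>UNIV. \<Sum>i\<in>UNIV. f i * (cmod (cinner (\<Phi> i) (\<Psi> j)))\<^sup>2)
      = (\<Sum>i\<in>UNIV. f i * (\<Sum>j\<in>UNIV. (cmod (cinner (\<Psi> j) (\<Phi> i)))\<^sup>2))"
    unfolding sum_distrib_left
    by (subst sum.swap) (simp add: cmod_cinner_commute)
  also have "\<dots> = (\<Sum>i\<in>UNIV. f i)"
    using assms by (simp add: orthonormal_basis_weights_sum orthonormal_basis_unit)
  finally show ?thesis .
qed

subsection \<open>Energies as quadratic forms\<close>

lemma sum_UNIV_prod: "(\<Sum>p\<in>UNIV. f p) = (\<Sum>a\<in>UNIV. \<Sum>b\<in>UNIV. f (a, b))"
  by (simp add: sum.cartesian_product flip: UNIV_Times_UNIV)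

lemma tensor_mat_1_mult_left:
  fixes P :: "'n::finite operator" and R :: "('m::finite \<times> 'n) operator"
  shows "((mat 1 \<otimes> P) ** R) $ (i, j) $ c = (\<Sum>m\<in>UNIV. P $ j $ m * R $ (i, m) $ c)"
  \<comment> \<open>The Kronecker delta of \<open>mat 1\<close> involves the outer index, so the
    swap brings that sum inside, where it collapses. The type of the inner set keeps the rewriting
    from looping.\<close>
  by (simp add: matrix_matrix_mult_def sum_UNIV_prod tensor_def mat_def if_distrib if_distribR
      sum.swap[of _ "UNIV :: 'n set"] cong: if_cong)

lemma tensor_mat_1_mult_right:
  fixes P :: "'n::finite operator" and R :: "('m::finite \<times> 'n) operator"
  shows "(R ** (mat 1 \<otimes> P)) $ r $ (k, l) = (\<Sum>m\<in>UNIV. R $ r $ (k, m) * P $ m $ l)"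
  by (simp add: matrix_matrix_mult_def sum_UNIV_prod tensor_def mat_def if_distrib if_distribR
      sum.swap[of _ "UNIV :: 'n set"] cong: if_cong)

lemma mult_tensor_mat_1:
  fixes H :: "'m::finite operator" and R :: "('m \<times> 'n::finite) operator"
  shows "(R ** (H \<otimes> mat 1)) $ r $ (k, l) = (\<Sum>m\<in>UNIV. R $ r $ (m, l) * H $ m $ k)"
  by (simp add: matrix_matrix_mult_def sum_UNIV_prod tensor_def mat_def if_distrib if_distribR
      cong: if_cong)

lemma mult_mat_nth: "(R ** mat c) $ r $ s = c * R $ r $ s" for R :: "'n::finite operator"
  by (simp add: matrix_matrix_mult_def mat_def if_distrib if_distribR mult.commute cong: if_cong)

lemma B_operator_nth:
  "B_operator HB \<rho> \<rho>X $ j $ l =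
     trace (battery_state \<rho> ** HB) * (\<Sum>i\<in>UNIV. ptrace_E (\<rho> \<otimes> \<rho>X) $ (i, j) $ (i, l))
     - (\<Sum>i\<in>UNIV. \<Sum>k\<in>UNIV. ptrace_E (\<rho> \<otimes> \<rho>X) $ (i, j) $ (k, l) * HB $ k $ i)"
  by (simp add: B_operator_def Z_operator_def ptrace_fst_def matrix_diff_ldistrib mult_mat_nth
      mult_tensor_mat_1 sum_subtractf sum_distrib_left)

lemma hermitian_ptrace_E_tensor:
  assumes "hermitian \<rho>" and "hermitian \<rho>X"
  shows "hermitian (ptrace_E (\<rho> \<otimes> \<rho>X))"
  by (auto simp: hermitian_def ptrace_E_def tensor_def hermitian_nth[OF assms(1)]
      hermitian_nth[OF assms(2)])

lemma trace_mult_hermitian_real: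
  fixes M N :: "'n::finite operator"
  assumes "hermitian M" and "hermitian N"
  shows "trace (M ** N) \<in> \<real>"
proof -
  have "cnj (trace (M ** N)) = (\<Sum>i\<in>UNIV. \<Sum>k\<in>UNIV. M $ k $ i * N $ i $ k)"
    by (simp add: trace_def matrix_matrix_mult_def hermitian_nth[OF assms(1)]
        hermitian_nth[OF assms(2)])
  also have "\<dots> = trace (M ** N)"
    unfolding trace_def matrix_matrix_mult_def by (subst sum.swap) simp
  finally show ?thesis
    by (simp add: Reals_cnj_iff)
qed

lemma hermitian_battery_state: "hermitian \<rho> \<Longrightarrow> hermitian (battery_state \<rho>)"
  unfolding hermitian_def[of "battery_state \<rho>"]
  by (simp add: battery_state_def ptrace_snd_def hermitian_nth)

text \<open>A product of Hermitian operators need not be Hermitian. Here, however, the Hamiltonian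
  acts on the traced factor alone, and the partial trace over it is cyclic for such operators, so
  the reversed order produced by the adjoint does not matter.\<close>

lemma hermitian_B_operator:
  assumes "hermitian HB" and "hermitian \<rho>" and "hermitian \<rho>X"
  shows "hermitian (B_operator HB \<rho> \<rho>X)"
  unfolding hermitian_def
proof (intro allI)
  fix j l
  let ?R = "ptrace_E (\<rho> \<otimes> \<rho>X)" and ?c = "trace (battery_state \<rho> ** HB)"
  have "cnj ?c = ?c"
    using trace_mult_hermitian_real[OF hermitian_battery_state assms(1)] assms(2)
    by (simp add: Reals_cnj_iff)
  then have "cnj (B_operator HB \<rho> \<rho>X $ l $ j) =
     ?c * (\<Sum>i\<in>UNIV. ?R $ (i, j) $ (i, l)) - (\<Sum>i\<in>UNIV. \<Sum>k\<in>UNIV. ?R $ (k, j) $ (i, l) * HB $ i $ k)"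
    by (simp add: B_operator_nth hermitian_nth[OF assms(1)]
        hermitian_nth[OF hermitian_ptrace_E_tensor[OF assms(2,3)]])
  also have "\<dots> = B_operator HB \<rho> \<rho>X $ j $ l"
    unfolding B_operator_nth by (subst (2) sum.swap) simp
  finally show "B_operator HB \<rho> \<rho>X $ j $ l = cnj (B_operator HB \<rho> \<rho>X $ l $ j)"
    by simp
qed

text \<open>The post-measurement state factorizes into an unnormalized battery state, given by the
  double sum, and the projector onto \<open>\<psi>\<close>.\<close>

lemma post_state_nth:
  "post_state \<rho> \<rho>X \<psi> $ (i, j) $ (k, l) = \<psi> $ j * cnj (\<psi> $ l) *
     (\<Sum>m\<in>UNIV. \<Sum>n\<in>UNIV. cnj (\<psi> $ m) * ptrace_E (\<rho> \<otimes> \<rho>X) $ (i, m) $ (k, n) * \<psi> $ n)"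
proof -
  have "post_state \<rho> \<rho>X \<psi> $ (i, j) $ (k, l) = (\<Sum>n\<in>UNIV. \<Sum>m\<in>UNIV. \<psi> $ j * cnj (\<psi> $ l) *
     (cnj (\<psi> $ m) * ptrace_E (\<rho> \<otimes> \<rho>X) $ (i, m) $ (k, n) * \<psi> $ n))"
    by (simp add: post_state_def tensor_mat_1_mult_left tensor_mat_1_mult_right projector_def
        sum_distrib_left sum_distrib_right mult_ac)
  also have "\<dots> = (\<Sum>m\<in>UNIV. \<Sum>n\<in>UNIV. \<psi> $ j * cnj (\<psi> $ l) *
     (cnj (\<psi> $ m) * ptrace_E (\<rho> \<otimes> \<rho>X) $ (i, m) $ (k, n) * \<psi> $ n))"
    by (rule sum.swap)
  finally show ?thesis
    by (simp add: sum_distrib_left)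
qed

text \<open>Both sides reduce to the same expression in the unnormalized battery state
  \<open>S\<close> left by the outcome: the initial mean energy times the trace of \<open>S\<close>,
  minus the trace of \<open>HB\<close> times \<open>S\<close>.\<close>

lemma weighted_energy_eq_quadratic_form:
  fixes \<rho> :: "('b::finite \<times> 'a::finite \<times> 'e::finite) operator" and \<rho>X :: "'x::finite operator"
  assumes "hermitian HB" and "hermitian \<rho>" and unit: "cinner \<psi> \<psi> = 1"
  shows "weighted_energy HB \<rho> \<rho>X \<psi> = Re (cinner \<psi> (B_operator HB \<rho> \<rho>X *v \<psi>))"
proof -
  let ?R = "ptrace_E (\<rho> \<otimes> \<rho>X)" and ?c = "trace (battery_state \<rho> ** HB)"
  define S where "S i k = (\<Sum>m\<in>UNIV. \<Sum>n\<in>UNIV. cnj (\<psi> $ m) * ?R $ (i, m) $ (k, n) * \<psi> $ n)" for i k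
  have c: "Im ?c = 0"
    using trace_mult_hermitian_real[OF hermitian_battery_state[OF assms(2)] assms(1)]
    by (simp add: complex_is_Real_iff)
  have red: "ptrace_snd (post_state \<rho> \<rho>X \<psi>) $ i $ k = S i k" for i k
  proof -
    have "ptrace_snd (post_state \<rho> \<rho>X \<psi>) $ i $ k = (\<Sum>j\<in>UNIV. cnj (\<psi> $ j) * \<psi> $ j) * S i k"
      by (simp add: ptrace_snd_def post_state_nth S_def sum_distrib_right mult_ac)
    then show ?thesis
      using unit by (simp add: cinner_def)
  qed
  have "trace (post_state \<rho> \<rho>X \<psi>) = (\<Sum>i\<in>UNIV. ptrace_snd (post_state \<rho> \<rho>X \<psi>) $ i $ i)"
    by (simp add: trace_def sum_UNIV_prod ptrace_snd_def)
  then have tr: "trace (post_state \<rho> \<rho>X \<psi>) = (\<Sum>i\<in>UNIV. S i i)"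
    by (simp add: red)
  have "trace (HB ** ptrace_snd (post_state \<rho> \<rho>X \<psi>)) = (\<Sum>k\<in>UNIV. \<Sum>i\<in>UNIV. HB $ k $ i * S i k)"
    by (simp add: trace_def matrix_matrix_mult_def red)
  also have "\<dots> = (\<Sum>i\<in>UNIV. \<Sum>k\<in>UNIV. HB $ k $ i * S i k)"
    by (rule sum.swap)
  finally have en: "trace (HB ** ptrace_snd (post_state \<rho> \<rho>X \<psi>)) = \<dots>" .
  \<comment> \<open>Moves a sum over a battery index out past the two sums over \<open>AX\<close>.
    The first term needs this once, the Hamiltonian term once for each of its two battery
    indices.\<close>
  have swap: "(\<Sum>j\<in>UNIV. \<Sum>l\<in>UNIV. \<Sum>i\<in>A. F i j l) = (\<Sum>i\<in>A. \<Sum>j\<in>UNIV. \<Sum>l\<in>UNIV. F i j l)"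
    for F :: "'i \<Rightarrow> 'a \<times> 'x \<Rightarrow> 'a \<times> 'x \<Rightarrow> complex" and A
    by (simp add: sum.swap[of _ A])
  have "cinner \<psi> (B_operator HB \<rho> \<rho>X *v \<psi>) = (\<Sum>j\<in>UNIV. \<Sum>l\<in>UNIV. cnj (\<psi> $ j) *
      (?c * (\<Sum>i\<in>UNIV. ?R $ (i, j) $ (i, l)) - (\<Sum>i\<in>UNIV. \<Sum>k\<in>UNIV. ?R $ (i, j) $ (k, l) * HB $ k $ i)) * \<psi> $ l)"
    by (simp add: cinner_def matrix_vector_mult_def sum_distrib_left B_operator_nth mult_ac)
  also have "\<dots> = (\<Sum>j\<in>UNIV. \<Sum>l\<in>UNIV. \<Sum>i\<in>UNIV. ?c * (cnj (\<psi> $ j) * ?R $ (i, j) $ (i, l) * \<psi> $ l))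
      - (\<Sum>j\<in>UNIV. \<Sum>l\<in>UNIV. \<Sum>i\<in>UNIV. \<Sum>k\<in>UNIV. HB $ k $ i * (cnj (\<psi> $ j) * ?R $ (i, j) $ (k, l) * \<psi> $ l))"
    by (simp add: right_diff_distrib left_diff_distrib sum_subtractf sum_distrib_left
        sum_distrib_right mult_ac)
  also have "\<dots> = ?c * (\<Sum>i\<in>UNIV. S i i) - (\<Sum>i\<in>UNIV. \<Sum>k\<in>UNIV. HB $ k $ i * S i k)"
    unfolding swap by (simp add: S_def sum_distrib_left)
  \<comment> \<open>The real part splits over the product because \<open>?c\<close> is real.\<close>
  also have "Re \<dots> = Re (\<Sum>i\<in>UNIV. S i i) * Re ?c - Re (\<Sum>i\<in>UNIV. \<Sum>k\<in>UNIV. HB $ k $ i * S i k)"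
    by (simp only: c minus_complex.sel times_complex.sel mult_zero_left diff_zero mult.commute)
  also have "\<dots> = weighted_energy HB \<rho> \<rho>X \<psi>"
    by (simp only: weighted_energy_def Let_def tr en)
  finally show ?thesis ..
qed

text \<open>Existence of a maximizer accompanies the value, since \<open>GREATEST\<close> is
  meaningful only if a greatest element exists.\<close>

lemma is_arg_max_GREATEST:
  fixes f :: "'a \<Rightarrow> real"
  assumes "P x" and "\<And>y. P y \<Longrightarrow> f y \<le> f x"
  shows "(\<exists>x. is_arg_max f P x) \<and> (GREATEST s. \<exists>y. P y \<and> s = f y) = f x"
proof
  show "\<exists>x. is_arg_max f P x"
    using assms by (auto simp: is_arg_max_linorder)
  show "(GREATEST s. \<exists>y. P y \<and> s = f y) = f x"
    using assms by (intro Greatest_equality) auto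
qed

theorem theorem1:
  fixes HB :: "'b::finite operator"
    and \<rho> :: "('b \<times> 'a::finite \<times> 'e::finite) operator"
    and \<rho>X :: "'x::finite operator"
    and \<beta> :: "'a \<times> 'x \<Rightarrow> complex"
  assumes "hermitian HB"
    and "density_operator \<rho>"
    and "density_operator \<rho>X"
    and "eigenvalue_family \<beta> (B_operator HB \<rho> \<rho>X)"
  shows "(\<forall>i. \<beta> i \<in> \<real>) \<and>
    (\<exists>\<Psi>. is_arg_max (distilled HB \<rho> \<rho>X) orthonormal_basis \<Psi>) \<and>
    S_D HB \<rho> \<rho>X = (\<Sum>i | Re (\<beta> i) > 0. Re (\<beta> i)) \<and>
    (\<exists>\<Psi>. is_arg_max (best_outcome HB \<rho> \<rho>X) orthonormal_basis \<Psi>) \<and>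
    S_max HB \<rho> \<rho>X = (MAX i. Re (\<beta> i)) \<and>
    (\<exists>\<Psi>. is_arg_max (average HB \<rho> \<rho>X) orthonormal_basis \<Psi>) \<and>
    S_av HB \<rho> \<rho>X = (\<Sum>i\<in>UNIV. Re (\<beta> i))"
proof -
  let ?B = "B_operator HB \<rho> \<rho>X" and ?w = "weighted_energy HB \<rho> \<rho>X"
  have herm: "hermitian \<rho>" "hermitian \<rho>X"
    using assms by (auto simp: density_operator_def)
  obtain \<Phi> b where \<Phi>: "orthonormal_basis \<Phi>" and \<beta>: "\<And>i. \<beta> i = complex_of_real (b i)"
      and eig: "\<And>i. ?B *v \<Phi> i = complex_of_real (b i) *s \<Phi> i"
    using hermitian_eigenvalue_family[OF hermitian_B_operator[OF assms(1) herm] assms(4)] by blast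
  \<comment> \<open>The doubly stochastic weights that express the energies of \<open>\<Psi>\<close>
    through the eigenvalues.\<close>
  let ?q = "\<lambda>\<Psi> i j. (cmod (cinner (\<Phi> i) (\<Psi> j)))\<^sup>2"
  have w: "?w (\<Psi> j) = (\<Sum>i\<in>UNIV. b i * ?q \<Psi> i j)" if "orthonormal_basis \<Psi>" for \<Psi> j
    by (simp add: weighted_energy_eq_quadratic_form[OF assms(1) herm(1)]
        orthonormal_basis_unit[OF that] quadratic_form_eigenbasis[OF \<Phi> eig])
  have q_sum: "(\<Sum>i\<in>UNIV. ?q \<Psi> i j) = 1" if "orthonormal_basis \<Psi>" for \<Psi> j
    by (rule orthonormal_basis_weights_sum[OF \<Phi> orthonormal_basis_unit[OF that]])
  have w_\<Phi>: "?w (\<Phi> j) = b j" for j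
    by (simp add: weighted_energy_eq_quadratic_form[OF assms(1) herm(1)] eig cinner_scale_right
        orthonormal_basis_unit[OF \<Phi>])
  \<comment> \<open>The set of outcomes with positive energy varies with \<open>\<Psi>\<close>;
    positive parts turn the sum into one over a fixed index set.\<close>
  have positive_part: "(\<Sum>i | f i > 0. f i) = (\<Sum>i\<in>UNIV. max 0 (f i))" for f :: "'a \<times> 'x \<Rightarrow> real"
    by (rule sum.mono_neutral_cong_left) (auto simp: max_def)
  have D: "distilled HB \<rho> \<rho>X \<Psi> \<le> distilled HB \<rho> \<rho>X \<Phi>" if "orthonormal_basis \<Psi>" for \<Psi>
  proof -
    \<comment> \<open>Jensen's inequality for the convex function \<open>max 0\<close>: the positive
      part of an average is at most the average of the positive parts.\<close>
    have "max 0 (?w (\<Psi> j)) \<le> (\<Sum>i\<in>UNIV. max 0 (b i) * ?q \<Psi> i j)" for j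
      unfolding w[OF that]
      by (intro max.boundedI sum_nonneg sum_mono mult_right_mono) auto
    then have "(\<Sum>j\<in>UNIV. max 0 (?w (\<Psi> j))) \<le> (\<Sum>j\<in>UNIV. \<Sum>i\<in>UNIV. max 0 (b i) * ?q \<Psi> i j)"
      by (rule sum_mono)
    also have "\<dots> = (\<Sum>i\<in>UNIV. max 0 (b i))"
      by (rule orthonormal_bases_average[OF \<Phi> that])
    finally show ?thesis
      by (simp add: distilled_def positive_part w_\<Phi>)
  qed
  have M: "best_outcome HB \<rho> \<rho>X \<Psi> \<le> best_outcome HB \<rho> \<rho>X \<Phi>" if "orthonormal_basis \<Psi>" for \<Psi>
  proof -
    have "?w (\<Psi> j) \<le> (MAX i. b i)" for j
    proof -
      \<comment> \<open>Each eigenvalue is replaced by the largest one, which then factors out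
        because the weights sum to one.\<close>
      have "?w (\<Psi> j) \<le> (\<Sum>i\<in>UNIV. (MAX i. b i) * ?q \<Psi> i j)"
        unfolding w[OF that] by (intro sum_mono mult_right_mono) auto
      then show ?thesis
        by (simp add: q_sum[OF that] flip: sum_distrib_left)
    qed
    then show ?thesis
      by (simp add: best_outcome_def w_\<Phi>)
  qed
  \<comment> \<open>The average is the same for every basis, so each of them, in particular
    \<open>\<Phi>\<close>, is a maximizer.\<close>
  have A: "average HB \<rho> \<rho>X \<Psi> = (\<Sum>i\<in>UNIV. b i)" if "orthonormal_basis \<Psi>" for \<Psi>
    using orthonormal_bases_average[OF \<Phi> that, of b] by (simp add: average_def w[OF that])
  show ?thesis
    using is_arg_max_GREATEST[of orthonormal_basis \<Phi> "distilled HB \<rho> \<rho>X", OF \<Phi> D]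
      is_arg_max_GREATEST[of orthonormal_basis \<Phi> "best_outcome HB \<rho> \<rho>X", OF \<Phi> M]
      is_arg_max_GREATEST[of orthonormal_basis \<Phi> "average HB \<rho> \<rho>X"] \<Phi> A
    by (simp add: S_D_def S_max_def S_av_def \<beta> distilled_def[of _ _ _ \<Phi>]
        best_outcome_def[of _ _ _ \<Phi>] w_\<Phi>)
qed

end
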